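(* For every numerical semigroup $H$, the automorphism group $\operatorname{Aut}(\mathcal P(H))$ is trivial; that is, the only automorphism of $\mathcal P(H)$ is the identity map.
   Context: $\mathbb N$ is the additive monoid of non-negative integers. A numerical semigroup is a subset $H \subseteq \mathbb N$ that is closed under addition and has finite complement in $\mathbb N$ (it need not contain $0$). $\mathcal P(H)$ denotes the family of all non-empty subsets (finite or infinite) of $H$, which is a semigroup under the sumset operation $X+Y := \{x+y : x\in X,\ y\in Y\}$. An automorphism is a bijective semigroup homomorphism from the structure to itself. *)

theory Defs
  imports
    "HOL-Algebra.Bij"
    "HOL-Algebra.Elementary_Groups"
    "HOL-Library.Set_Algebras"
begin

definition numerical_semigroup :: "nat set \<Rightarrow> bool"
  where "numerical_semigroup H \<longleftrightarrow> (\<forall>x\<in>H. \<forall>y\<in>H. x + y \<in> H) \<and> finite (UNIV - H)"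

text \<open>
  The semigroup of all non-empty subsets of \<open>H\<close> under the sumset operation, which is \<open>+\<close> on sets
  from \<^theory>\<open>HOL-Library.Set_Algebras\<close>. The record type requires a \<open>one\<close> field; \<open>{0}\<close> is the
  identity if \<open>0 \<in> H\<close>, and otherwise lies outside the carrier and is merely a filler.
  The constants \<open>hom\<close>, \<open>auto\<close> and \<open>AutoGroup\<close> never refer to the \<open>one\<close> field of their argument,
  so \<open>auto\<close> consists of exactly the semigroup automorphisms in either case.
\<close>

definition power_semigroup :: "nat set \<Rightarrow> nat set monoid"
  where "power_semigroup H = \<lparr>carrier = {X. X \<subseteq> H \<and> X \<noteq> {}}, mult = (+), one = {0}\<rparr>"

text \<open>
  Elements of \<open>AutoGroup\<close> are extensional functions, so that each automorphism of the carrier has a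
  single representative. The following confirms that its triviality has the intended meaning.
\<close>

lemma trivial_AutoGroup_power_semigroup_iff:
  "trivial_group (AutoGroup (power_semigroup H)) \<longleftrightarrow>
    (\<forall>f. bij_betw f {X. X \<subseteq> H \<and> X \<noteq> {}} {X. X \<subseteq> H \<and> X \<noteq> {}} \<and>
         (\<forall>X Y. X \<subseteq> H \<and> X \<noteq> {} \<and> Y \<subseteq> H \<and> Y \<noteq> {} \<longrightarrow> f (X + Y) = f X + f Y)
      \<longrightarrow> (\<forall>X. X \<subseteq> H \<and> X \<noteq> {} \<longrightarrow> f X = X))"
  if H: "\<forall>x\<in>H. \<forall>y\<in>H. x + y \<in> H"
proof -
  define S where "S = {X. X \<subseteq> H \<and> X \<noteq> {}}"
  have closed: "X + Y \<in> S" if "X \<in> S" "Y \<in> S" for X Y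
    using that H by (fastforce simp: S_def set_plus_def)
  have autoI: "f \<in> auto (power_semigroup H) \<longleftrightarrow> f \<in> extensional S \<and> bij_betw f S S \<and>
      (\<forall>X\<in>S. \<forall>Y\<in>S. f (X + Y) = f X + f Y)" for f
    by (auto simp: auto_def hom_def Bij_def power_semigroup_def S_def[symmetric]
        dest: bij_betw_imp_funcset)
  have car: "carrier (AutoGroup (power_semigroup H)) = auto (power_semigroup H)"
    and one: "\<one>\<^bsub>AutoGroup (power_semigroup H)\<^esub> = (\<lambda>X\<in>S. X)"
    and mult: "mult (AutoGroup (power_semigroup H)) = (\<lambda>g\<in>Bij S. \<lambda>f\<in>Bij S. compose S g f)"
    by (simp_all add: AutoGroup_def BijGroup_def power_semigroup_def S_def)
  have id_auto: "(\<lambda>X\<in>S. X) \<in> auto (power_semigroup H)"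
    using id_Bij[of S] closed by (auto simp: autoI Bij_def)
  have "trivial_group (AutoGroup (power_semigroup H)) \<longleftrightarrow> auto (power_semigroup H) = {\<lambda>X\<in>S. X}"
  proof
    assume "trivial_group (AutoGroup (power_semigroup H))"
    then show "auto (power_semigroup H) = {\<lambda>X\<in>S. X}"
      by (simp add: trivial_group_def car one)
  next
    assume eq: "auto (power_semigroup H) = {\<lambda>X\<in>S. X}"
    have "group (AutoGroup (power_semigroup H))"
      by (rule groupI) (simp_all add: car one mult eq id_Bij)
    then show "trivial_group (AutoGroup (power_semigroup H))"
      by (simp add: trivial_group_def car one eq)
  qed
  also have "\<dots> \<longleftrightarrow> (\<forall>f. bij_betw f S S \<and> (\<forall>X\<in>S. \<forall>Y\<in>S. f (X + Y) = f X + f Y) \<longrightarrow>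
      (\<forall>X\<in>S. f X = X))" (is "_ \<longleftrightarrow> ?R")
  proof
    assume eq: "auto (power_semigroup H) = {\<lambda>X\<in>S. X}"
    show ?R
    proof (intro allI impI ballI)
      fix f X
      assume f: "bij_betw f S S \<and> (\<forall>X\<in>S. \<forall>Y\<in>S. f (X + Y) = f X + f Y)" and X: "X \<in> S"
      have "bij_betw (restrict f S) S S"
        using f bij_betw_cong[of S f "restrict f S" S] by (metis restrict_apply')
      then have "restrict f S \<in> auto (power_semigroup H)"
        unfolding autoI using f closed by (metis restrict_apply' restrict_extensional)
      then have "restrict f S = (\<lambda>X\<in>S. X)"
        using eq by simp
      then show "f X = X"
        using X by (metis restrict_apply')
    qed
  next
    assume R: ?R
    have "f = (\<lambda>X\<in>S. X)" if "f \<in> auto (power_semigroup H)" for f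
    proof (rule extensionalityI)
      show "f \<in> extensional S"
        using that by (simp add: autoI)
      show "f X = (\<lambda>X\<in>S. X) X" if "X \<in> S" for X
        using R \<open>f \<in> auto (power_semigroup H)\<close> that unfolding autoI by (metis restrict_apply')
    qed (rule restrict_extensional)
    then show "auto (power_semigroup H) = {\<lambda>X\<in>S. X}"
      using id_auto by blast
  qed
  finally show ?thesis
    unfolding S_def Ball_def mem_Collect_eq by (simp only: conj_assoc imp_conjL all_simps)
qed

end

theory Submission
  imports Defs
begin

text \<open>
  Let \<open>f\<close> be an automorphism of the semigroup of non-empty subsets of \<open>H\<close>. The proof recovers
  enough of each set from the semigroup operation alone to force \<open>f X = X\<close>.

  The singletons are exactly the cancellative elements (\<open>cancellative_imp_singleton\<close>), so \<open>f\<close>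
  induces an automorphism of \<open>H\<close>. Additive maps on \<open>H\<close> are multiplications by a constant, so this
  automorphism is the identity (\<open>additive_bij_is_identity\<close>): \<open>f\<close> fixes every singleton and
  commutes with translations. If \<open>{c..} \<subseteq> H\<close>, then \<open>X + {c..}\<close> is the translate of \<open>{c..}\<close> by the
  least element of \<open>X\<close>; this makes \<open>f\<close> fix \<open>{c..}\<close> and preserve least elements.

  Shifting by \<open>c\<close> therefore turns \<open>f\<close> into an automorphism \<open>g\<close> of the monoid of all subsets of the
  natural numbers that contain \<open>0\<close>. Its elements \<open>- {k}\<close> with \<open>k > 0\<close> are those whose only proper
  multiple is the zero element \<open>UNIV\<close>. Their stabilizers \<open>{A. A \<inter> {1..k} = {}}\<close> shrink as \<open>k\<close>
  grows, so \<open>g\<close> fixes each \<open>- {k}\<close>, and hence also the zero element \<open>{0} \<union> {k+1..}\<close> of the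
  stabilizer. Adding \<open>{0} \<union> {k..}\<close> to \<open>A\<close> yields \<open>A \<union> {k..}\<close>, so \<open>g\<close> commutes with forgetting
  everything from \<open>k\<close> on. By induction on \<open>k\<close>, \<open>g\<close> fixes \<open>A \<union> {k..}\<close> for all \<open>A\<close> and \<open>k\<close>, and
  these sets together determine \<open>A\<close>. The use of infinite sets is essential: on the
  non-empty finite sets of natural numbers, the reversal of \<open>X\<close>, which replaces each element \<open>x\<close>
  by \<open>Max X + Min X - x\<close>, is a non-trivial automorphism.
\<close>

section \<open>Subsets of the natural numbers that contain zero\<close>

lemma add_tail_eq_Un:
  fixes A :: "nat set"
  assumes "0 \<in> A"
  shows "A + ({0} \<union> {k..}) = A \<union> {k..}"
proof (intro equalityI subsetI)
  fix x assume "x \<in> A + ({0} \<union> {k..})"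
  then show "x \<in> A \<union> {k..}" by (auto simp: set_plus_def)
next
  fix x assume "x \<in> A \<union> {k..}"
  then show "x \<in> A + ({0} \<union> {k..})"
    using assms set_plus_intro[of x A 0 "{0} \<union> {k..}"] set_plus_intro[of 0 A x "{0} \<union> {k..}"] by auto
qed

lemma subset_add_if_zero_mem:
  fixes A B :: "nat set"
  assumes "0 \<in> A"
  shows "B \<subseteq> A + B"
proof
  fix x assume "x \<in> B"
  then show "x \<in> A + B" using set_plus_intro[OF assms, of x B] by simp
qed

lemma add_UNIV_if_zero_mem: "0 \<in> A \<Longrightarrow> A + UNIV = (UNIV :: nat set)"
  using subset_add_if_zero_mem[of A UNIV] by auto

lemma mem_add_Compl_singleton_iff:
  fixes A :: "nat set"
  shows "k \<in> A + - {k} \<longleftrightarrow> (\<exists>a\<in>A. 0 < a \<and> a \<le> k)"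
proof
  assume "k \<in> A + - {k}"
  then show "\<exists>a\<in>A. 0 < a \<and> a \<le> k" by (auto simp: set_plus_def)
next
  assume "\<exists>a\<in>A. 0 < a \<and> a \<le> k"
  then obtain a where "a \<in> A" "0 < a" "a \<le> k" by blast
  then show "k \<in> A + - {k}"
    using set_plus_intro[of a A "k - a" "- {k}"] by auto
qed

lemma add_Compl_singleton:
  fixes A :: "nat set"
  assumes "0 \<in> A"
  shows "A + - {k} = (if \<exists>a\<in>A. 0 < a \<and> a \<le> k then UNIV else - {k})"
proof -
  have "- {k} \<subseteq> A + - {k}" using assms by (rule subset_add_if_zero_mem)
  then show ?thesis using mem_add_Compl_singleton_iff[of k A] by auto
qed

text \<open>
  A set \<open>B\<close> with least missing element \<open>k\<close> has the multiple \<open>B \<union> {k+1..} = - {k}\<close>, so if its only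
  multiples are itself and \<open>UNIV\<close>, nothing else can be missing.
\<close>

lemma only_proper_multiple_UNIV_iff:
  fixes B :: "nat set"
  assumes "0 \<in> B"
  shows "B \<noteq> UNIV \<and> (\<forall>A. 0 \<in> A \<longrightarrow> A + B \<in> {B, UNIV}) \<longleftrightarrow> (\<exists>k>0. B = - {k})"
proof
  assume L: "B \<noteq> UNIV \<and> (\<forall>A. 0 \<in> A \<longrightarrow> A + B \<in> {B, UNIV})"
  define k where "k = (LEAST k. k \<notin> B)"
  from L obtain i where "i \<notin> B" by blast
  then have k: "k \<notin> B" unfolding k_def by (rule LeastI)
  have below: "j \<in> B" if "j < k" for j using that not_less_Least unfolding k_def by blast
  have "x \<in> B \<union> {Suc k..} \<longleftrightarrow> x \<in> - {k}" for x
    using k below[of x] by (cases x k rule: linorder_cases) auto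
  then have "B \<union> {Suc k..} = - {k}" by blast
  then have "({0} \<union> {Suc k..}) + B = - {k}"
    using add_tail_eq_Un[OF assms, of "Suc k"] by (simp add: add.commute)
  moreover have "({0} \<union> {Suc k..}) + B \<in> {B, UNIV}" using L by blast
  ultimately have "B = - {k}" by auto
  moreover have "k > 0" using k assms by (cases k) auto
  ultimately show "\<exists>k>0. B = - {k}" by blast
next
  assume "\<exists>k>0. B = - {k}"
  then obtain k where "B = - {k}" by blast
  moreover have "A + - {k} \<in> {- {k}, UNIV}" if "0 \<in> A" for A
    using add_Compl_singleton[OF that] by simp
  ultimately show "B \<noteq> UNIV \<and> (\<forall>A. 0 \<in> A \<longrightarrow> A + B \<in> {B, UNIV})" by blast
qed

text \<open>
  Every set \<open>A\<close> is determined by its truncations \<open>A \<union> {k..}\<close>, so once \<open>g\<close> is known to commute with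
  truncation at every \<open>k\<close>, one membership at a time remains to be checked.
\<close>

lemma zero_subsets_automorphism_is_identity:
  fixes g :: "nat set \<Rightarrow> nat set"
  assumes bij: "bij_betw g {X. 0 \<in> X} {X. 0 \<in> X}"
    and hom: "\<And>X Y. 0 \<in> X \<Longrightarrow> 0 \<in> Y \<Longrightarrow> g (X + Y) = g X + g Y"
    and X: "0 \<in> X"
  shows "g X = X"
proof -
  have mem: "0 \<in> g A" if "0 \<in> A" for A using bij_betwE[OF bij] that by auto
  have inj: "A = B" if "0 \<in> A" "0 \<in> B" "g A = g B" for A B
    using bij_betw_imp_inj_on[OF bij] that by (auto dest: inj_onD)
  have surj: "\<exists>A. 0 \<in> A \<and> g A = B" if "0 \<in> B" for B
    using bij_betw_imp_surj_on[OF bij] that by (metis image_iff mem_Collect_eq)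
  have zero_add: "0 \<in> A + B" if "0 \<in> A" "0 \<in> B" for A B :: "nat set"
    using set_plus_intro[OF that] by simp

  have UNIV: "g UNIV = UNIV"
  proof -
    obtain A where A: "0 \<in> A" "g A = UNIV" using surj[of UNIV] by auto
    have "g UNIV = g (A + UNIV)" using A by (simp add: add_UNIV_if_zero_mem)
    also have "\<dots> = g UNIV + UNIV" using A hom[of A UNIV] by (simp add: add.commute)
    finally show ?thesis using mem[of UNIV] by (simp add: add_UNIV_if_zero_mem)
  qed

  have coatom_iff: "(\<exists>k>0. g B = - {k}) \<longleftrightarrow> (\<exists>k>0. B = - {k})" if B: "0 \<in> B" for B
  proof -
    have "g B \<noteq> UNIV \<longleftrightarrow> B \<noteq> UNIV" using inj[of B UNIV] B UNIV by auto
    moreover have "g A + g B \<in> {g B, UNIV} \<longleftrightarrow> A + B \<in> {B, UNIV}" if "0 \<in> A" for A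
      using inj[of "A + B" B] inj[of "A + B" UNIV] zero_add[OF that B] hom[OF that B] B UNIV by auto
    then have "(\<forall>A. 0 \<in> A \<longrightarrow> A + g B \<in> {g B, UNIV}) \<longleftrightarrow> (\<forall>A. 0 \<in> A \<longrightarrow> A + B \<in> {B, UNIV})"
      by (metis mem surj)
    ultimately show ?thesis
      using only_proper_multiple_UNIV_iff[OF B] only_proper_multiple_UNIV_iff[OF mem[OF B]] by simp
  qed

  have Compl: "g (- {k}) = - {k}" if "k > 0" for k
    using that
  proof (induction k rule: less_induct)
    case (less k)
    have zero: "0 \<in> - {k}" using less.prems by simp
    obtain k' where k': "k' > 0" "g (- {k}) = - {k'}" using coatom_iff[OF zero] less.prems by auto
    obtain B where B: "0 \<in> B" "g B = - {k}" using surj[OF zero] by auto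
    obtain l where l: "l > 0" "B = - {l}" using coatom_iff[OF B(1)] B(2) less.prems by auto
    have "l \<ge> k"
    proof (rule ccontr)
      assume "\<not> l \<ge> k"
      then have "- {l} = - {k}" using less.IH[of l] l B(2) by simp
      then show False using \<open>\<not> l \<ge> k\<close> by auto
    qed
    have "k' \<ge> k"
    proof (rule ccontr)
      assume "\<not> k' \<ge> k"
      then have "- {k} = - {k'}" using less.IH[of k'] inj[OF zero, of "- {k'}"] k' by simp
      then show False using \<open>\<not> k' \<ge> k\<close> by auto
    qed
    \<comment> \<open>The set \<open>{0, k'}\<close> tells the stabilizers of \<open>- {k}\<close> and \<open>- {k'}\<close> apart if \<open>k < k'\<close>. It has a
      preimage under \<open>g\<close>, which stabilizes \<open>- {l}\<close> and hence also \<open>- {k}\<close>.\<close>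
    have "k' \<le> k"
    proof (rule ccontr)
      assume "\<not> k' \<le> k"
      obtain A where A: "0 \<in> A" "g A = {0, k'}" using surj[of "{0, k'}"] by auto
      have "g (A + - {l}) = {0, k'} + - {k}" using hom[of A "- {l}"] A B l by simp
      also have "\<dots> = g (- {l})" using \<open>\<not> k' \<le> k\<close> B l by (simp add: add_Compl_singleton)
      finally have "A + - {l} = - {l}" using inj[of "A + - {l}" "- {l}"] zero_add A B l by auto
      then have "\<not> (\<exists>a\<in>A. 0 < a \<and> a \<le> l)" using A(1) by (auto simp: add_Compl_singleton split: if_splits)
      then have "A + - {k} = - {k}" using \<open>l \<ge> k\<close> A(1) by (auto simp: add_Compl_singleton)
      then have "{0, k'} + - {k'} = - {k'}" using hom[OF A(1) zero] A(2) k'(2) by simp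
      then show False using k'(1) by (auto simp: add_Compl_singleton split: if_splits)
    qed
    with \<open>k' \<ge> k\<close> k' show ?case by simp
  qed

  have tail: "g ({0} \<union> {k..}) = {0} \<union> {k..}" for k
  proof (cases "k \<le> 1")
    case True
    then have "{0} \<union> {k..} = UNIV" by auto
    then show ?thesis using UNIV by simp
  next
    case False
    \<comment> \<open>\<open>E\<close> is the zero element of the stabilizer of \<open>- {j}\<close>. Since \<open>g\<close> fixes \<open>- {j}\<close>, it maps this
      stabilizer onto itself, and a semigroup has at most one zero element.\<close>
    define j E where "j = k - 1" and "E = {0} \<union> {k..}"
    have j: "j > 0" "k = Suc j" and zero: "0 \<in> E" "0 \<in> - {j}" using False by (auto simp: j_def E_def)
    have absorb: "A + E = E" if "0 \<in> A" "A + - {j} = - {j}" for A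
    proof -
      have "\<not> (\<exists>a\<in>A. 0 < a \<and> a \<le> j)" using that by (auto simp: add_Compl_singleton split: if_splits)
      then have "A \<union> {k..} = E" using that(1) unfolding E_def j(2) by force
      then show ?thesis using add_tail_eq_Un[OF that(1), of k] by (simp add: E_def)
    qed
    have stab: "E + - {j} = - {j}" using zero(1) j by (auto simp: add_Compl_singleton E_def)
    then have "g E + - {j} = - {j}" using hom[OF zero] Compl[OF j(1)] by simp
    then have "g E + E = E" using absorb mem zero by blast
    moreover obtain A where A: "0 \<in> A" "g A = E" using surj zero(1) by blast
    have "g (A + - {j}) = g (- {j})" using hom[OF A(1) zero(2)] A(2) Compl[OF j(1)] stab by simp
    then have "A + - {j} = - {j}" using inj[OF zero_add[OF A(1) zero(2)] zero(2)] by simp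
    then have "A + E = E" using absorb A(1) by blast
    then have "E + g E = g E" using hom[OF A(1) zero(1)] A(2) by simp
    ultimately show ?thesis by (simp add: add.commute E_def)
  qed

  have Un_tail: "g (A \<union> {k..}) = g A \<union> {k..}" if "0 \<in> A" for A k
    using hom[OF that, of "{0} \<union> {k..}"] tail[of k] add_tail_eq_Un that mem by simp

  have cofinite: "g (A \<union> {k..}) = A \<union> {k..}" if "0 \<in> A" for A k
  proof (induction k)
    case 0
    have "A \<union> {0..} = UNIV" by auto
    then show ?case using UNIV by simp
  next
    case (Suc k)
    \<comment> \<open>By the induction hypothesis, \<open>g B\<close> and \<open>B\<close> agree except possibly at \<open>k\<close>. If \<open>k\<close> were in
      \<open>g B\<close> but not in \<open>B\<close>, then \<open>g B\<close> would be \<open>A \<union> {k..}\<close>, the image of a different set.\<close>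
    define B where "B = A \<union> {Suc k..}"
    have split: "{k..} = insert k {Suc k..}" by auto
    have zero: "0 \<in> B" using that by (simp add: B_def)
    have Bk: "B \<union> {k..} = A \<union> {k..}" by (auto simp: B_def)
    have above: "{Suc k..} \<subseteq> g B" using Un_tail[OF that, of "Suc k"] by (auto simp: B_def)
    have ins: "insert k (g B) = A \<union> {k..}"
      using Un_tail[OF zero, of k] Bk Suc above split by auto
    show ?case
    proof (cases "k \<in> A")
      case True
      then have "B = A \<union> {k..}" by (auto simp: B_def split)
      then show ?thesis using Suc by (simp add: B_def)
    next
      case False
      have "k \<notin> g B"
      proof
        assume "k \<in> g B"
        then have "g B = g (A \<union> {k..})" using ins Suc by (simp add: insert_absorb)
        then have "B = A \<union> {k..}" using inj[OF zero] that by blast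
        then show False using False by (auto simp: B_def)
      qed
      moreover have "A \<union> {k..} = insert k B" "k \<notin> B" using False by (auto simp: B_def split)
      ultimately have "g B = B" using ins by (metis insert_ident)
      then show ?thesis by (simp add: B_def)
    qed
  qed

  have "n \<in> g X \<longleftrightarrow> n \<in> X" for n
  proof -
    have "g X \<union> {Suc n..} = X \<union> {Suc n..}" using Un_tail[OF X] cofinite[OF X] by simp
    then have "n \<in> g X \<union> {Suc n..} \<longleftrightarrow> n \<in> X \<union> {Suc n..}" by simp
    then show ?thesis by simp
  qed
  then show ?thesis by blast
qed

section \<open>Singletons\<close>

lemma singleton_add_inject: "{a} + X = {a} + Y \<Longrightarrow> X = (Y :: nat set)"
proof -
  have "{a} + Z = (+) a ` Z" for Z :: "nat set" by (auto simp: set_plus_def)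
  then show "{a} + X = {a} + Y \<Longrightarrow> X = Y" by (simp add: inj_image_eq_iff)
qed

text \<open>
  If \<open>a < b\<close> are in \<open>A\<close> with \<open>a\<close> minimal, then removing \<open>c + (b - a)\<close> from \<open>{c..}\<close> does not change
  the sum with \<open>A\<close>: the element \<open>a + (c + (b - a))\<close> is also \<open>b + c\<close>.
\<close>

lemma cancellative_imp_singleton:
  fixes A :: "nat set"
  assumes "A \<noteq> {}"
    and canc: "\<And>X Y. X \<subseteq> {c..} \<Longrightarrow> Y \<subseteq> {c..} \<Longrightarrow> X \<noteq> {} \<Longrightarrow> Y \<noteq> {} \<Longrightarrow> A + X = A + Y \<Longrightarrow> X = Y"
  shows "\<exists>a. A = {a}"
proof (rule ccontr)
  assume no: "\<nexists>a. A = {a}"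
  define a where "a = Inf A"
  have a: "a \<in> A" "\<And>x. x \<in> A \<Longrightarrow> a \<le> x" using assms(1) by (auto simp: a_def Inf_nat_def1 wellorder_Inf_le1)
  obtain b where b: "b \<in> A" "a < b" using no a 
    by (metis insertI1 le_neq_implies_less singletonD subsetI subset_antisym empty_subsetI insert_subset)
  define Y where "Y = {c..} - {c + (b - a)}"
  have "c \<in> Y" using b by (simp add: Y_def)
  have "A + {c..} \<subseteq> A + Y"
  proof
    fix z assume "z \<in> A + {c..}"
    then obtain x y where xy: "x \<in> A" "c \<le> y" "z = x + y" by (auto elim: set_plus_elim)
    show "z \<in> A + Y"
    proof (cases "z = b + c")
      case True
      then show ?thesis using set_plus_intro[OF b(1) \<open>c \<in> Y\<close>] by simp
    next
      case False
      then have "z - a \<in> Y" using xy a(2)[OF xy(1)] b by (auto simp: Y_def)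
      then have "a + (z - a) \<in> A + Y" using a(1) by blast
      then show ?thesis using xy a(2)[OF xy(1)] by simp
    qed
  qed
  moreover have "A + Y \<subseteq> A + {c..}" by (rule set_plus_mono2) (auto simp: Y_def)
  ultimately have "{c..} = Y" using canc[of "{c..}" Y] \<open>c \<in> Y\<close> unfolding Y_def by blast
  moreover have "c + (b - a) \<in> {c..}" "c + (b - a) \<notin> Y" by (auto simp: Y_def)
  ultimately show False by blast
qed

text \<open>
  Evaluating \<open>h\<close> at \<open>x * y\<close> in two ways gives \<open>h x * y = h y * x\<close>. As \<open>m\<close> and \<open>m + 1\<close> are coprime,
  \<open>h\<close> is multiplication by a natural number, which divides every value of \<open>h\<close>; since \<open>m\<close> and
  \<open>m + 1\<close> are values, it is \<open>1\<close>.
\<close>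

lemma additive_bij_is_identity:
  fixes h :: "nat \<Rightarrow> nat"
  assumes closed: "\<And>x y. x \<in> H \<Longrightarrow> y \<in> H \<Longrightarrow> x + y \<in> H"
    and cof: "{c..} \<subseteq> H"
    and surj: "H \<subseteq> h ` H"
    and add: "\<And>x y. x \<in> H \<Longrightarrow> y \<in> H \<Longrightarrow> h (x + y) = h x + h y"
    and x: "x \<in> H"
  shows "h x = x"
proof -
  have mult: "Suc n * x \<in> H \<and> h (Suc n * x) = Suc n * h x" if "x \<in> H" for n x
    by (induction n) (use that closed add in auto)
  have zero: "h 0 = 0" if "0 \<in> H" using add[OF that that] by simp
  have cross: "h x * y = h y * x" if "x \<in> H" "y \<in> H" for x y
  proof (cases "x = 0 \<or> y = 0")
    case True
    then show ?thesis using zero that by auto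
  next
    case False
    then obtain i j where "x = Suc i" "y = Suc j" by (metis not0_implies_Suc)
    then have "h (x * y) = x * h y" "h (y * x) = y * h x"
      using mult[OF that(2), of i] mult[OF that(1), of j] by auto
    then show ?thesis by (simp add: mult.commute)
  qed
  define m where "m = Suc c"
  have m: "m \<in> H" "Suc m \<in> H" "m > 0" using cof by (auto simp: m_def)
  have "m dvd h m * Suc m" using cross[OF m(1,2)] by simp
  then have "m dvd h m" using coprime_dvd_mult_left_iff[of m "Suc m" "h m"] by simp
  then obtain q where q: "h m = m * q" by (elim dvdE)
  have hq: "h y = q * y" if "y \<in> H" for y
  proof -
    have "h y * m = (q * y) * m" using cross[OF that m(1)] q by (simp add: ac_simps)
    then show ?thesis using m(3) by simp
  qed
  have "q dvd y" if "y \<in> H" for y using surj that hq by (metis dvd_triv_left imageE subsetD)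
  then have "q dvd m" "q dvd Suc m" using m by auto
  then have "q = 1" by (metis dvd_add_right_iff Suc_eq_plus1 nat_dvd_1_iff_1)
  then show ?thesis using hq[OF x] by simp
qed

section \<open>Automorphisms of the power semigroup\<close>

lemma add_atLeast_eq:
  fixes X :: "nat set"
  assumes "X \<noteq> {}"
  shows "X + {c..} = {Inf X + c..}"
proof (intro equalityI subsetI)
  fix z assume "z \<in> X + {c..}"
  then show "z \<in> {Inf X + c..}" by (auto simp: set_plus_def intro: add_mono wellorder_Inf_le1)
next
  fix z assume "z \<in> {Inf X + c..}"
  then show "z \<in> X + {c..}"
    using set_plus_intro[OF Inf_nat_def1[OF assms], of "z - Inf X" "{c..}"] by auto
qed

lemma Inf_add:
  fixes X Y :: "nat set"
  assumes "X \<noteq> {}" "Y \<noteq> {}"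
  shows "Inf (X + Y) = Inf X + Inf Y"
proof (rule cInf_eq_minimum)
  show "Inf X + Inf Y \<in> X + Y" using assms by (intro set_plus_intro Inf_nat_def1)
  show "Inf X + Inf Y \<le> z" if "z \<in> X + Y" for z
    using that by (auto simp: set_plus_def intro: add_mono wellorder_Inf_le1)
qed

text \<open>
  Fixing singletons makes \<open>f\<close> commute with translations, and fixing \<open>{c..}\<close> makes it preserve least
  elements. So \<open>f\<close> permutes the sets with least element \<open>c\<close>, which are the sets \<open>{c} + A\<close> with
  \<open>0 \<in> A\<close>, and every set has a translate of this form.
\<close>

lemma power_semigroup_automorphism_is_identity:
  fixes f :: "nat set \<Rightarrow> nat set"
  assumes closed: "\<And>x y. x \<in> H \<Longrightarrow> y \<in> H \<Longrightarrow> x + y \<in> H"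
    and cof: "{c..} \<subseteq> H"
    and bij: "bij_betw f {X. X \<subseteq> H \<and> X \<noteq> {}} {X. X \<subseteq> H \<and> X \<noteq> {}}"
    and hom: "\<And>X Y. X \<subseteq> H \<Longrightarrow> X \<noteq> {} \<Longrightarrow> Y \<subseteq> H \<Longrightarrow> Y \<noteq> {} \<Longrightarrow> f (X + Y) = f X + f Y"
    and X: "X \<subseteq> H" "X \<noteq> {}"
  shows "f X = X"
proof -
  define S where "S = {X. X \<subseteq> H \<and> X \<noteq> {}}"
  note bij = bij[folded S_def]
  have mem: "f A \<in> S" if "A \<in> S" for A using bij_betwE[OF bij] that by auto
  have inj: "A = B" if "A \<in> S" "B \<in> S" "f A = f B" for A B
    using bij_betw_imp_inj_on[OF bij] that by (auto dest: inj_onD)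
  have surj: "\<exists>A\<in>S. f A = B" if "B \<in> S" for B
    using bij_betw_imp_surj_on[OF bij] that by (metis image_iff)
  have plus: "A + B \<in> S" if "A \<in> S" "B \<in> S" for A B
    using that closed unfolding S_def by (fastforce simp: set_plus_def)
  have hom: "f (A + B) = f A + f B" if "A \<in> S" "B \<in> S" for A B
    using hom that by (auto simp: S_def)
  have ne: "A \<noteq> {}" if "A \<in> S" for A using that by (simp add: S_def)
  have sing: "{x} \<in> S \<longleftrightarrow> x \<in> H" for x by (simp add: S_def)
  have above: "A \<in> S" if "A \<subseteq> {c..}" "A \<noteq> {}" for A using that cof by (auto simp: S_def)

  \<comment> \<open>Both \<open>f\<close> and its inverse preserve cancellativity, hence map singletons to singletons.\<close>
  have f_sing: "\<exists>y. f {x} = {y}" if x: "x \<in> H" for x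
  proof (rule cancellative_imp_singleton)
    show "f {x} \<noteq> {}" using mem ne sing x by blast
    fix A B assume "A \<subseteq> {c..}" "B \<subseteq> {c..}" "A \<noteq> {}" "B \<noteq> {}" and eq: "f {x} + A = f {x} + B"
    then obtain A' B' where AB: "A' \<in> S" "B' \<in> S" "f A' = A" "f B' = B" using surj above by metis
    then have "f ({x} + A') = f ({x} + B')" using hom eq sing x by simp
    then have "{x} + A' = {x} + B'" using inj plus AB sing x by blast
    then show "A = B" using singleton_add_inject AB by blast
  qed
  have f_sing_inv: "\<exists>y\<in>H. f {y} = {x}" if x: "x \<in> H" for x
  proof -
    obtain A where A: "A \<in> S" "f A = {x}" using surj sing x by metis
    have "\<exists>a. A = {a}"
    proof (rule cancellative_imp_singleton)
      show "A \<noteq> {}" using ne A by blast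
      fix B C assume "B \<subseteq> {c..}" "C \<subseteq> {c..}" "B \<noteq> {}" "C \<noteq> {}" and eq: "A + B = A + C"
      then have BC: "B \<in> S" "C \<in> S" using above by auto
      then have "{x} + f B = {x} + f C" using hom[of A B] hom[of A C] A eq by simp
      then have "f B = f C" by (rule singleton_add_inject)
      then show "B = C" using inj BC by blast
    qed
    then show ?thesis using A sing by auto
  qed

  define h where "h = (\<lambda>x. THE y. f {x} = {y})"
  have h: "f {x} = {h x}" if "x \<in> H" for x
    using f_sing[OF that] unfolding h_def by auto
  have h_id: "h x = x" if "x \<in> H" for x
  proof (rule additive_bij_is_identity[OF closed cof _ _ that])
    show "H \<subseteq> h ` H"
    proof
      fix y assume "y \<in> H"
      then obtain x where "x \<in> H" "f {x} = {y}" using f_sing_inv by blast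
      then show "y \<in> h ` H" using h[of x] by auto
    qed
    fix x y assume xy: "x \<in> H" "y \<in> H"
    have "f ({x} + {y}) = f {x} + f {y}" using hom sing xy by simp
    moreover have "{x} + {y} = {x + y}" "{h x} + {h y} = {h x + h y}" by (auto simp: set_plus_def)
    ultimately show "h (x + y) = h x + h y" using h xy closed by simp
  qed
  have f_single: "f {x} = {x}" if "x \<in> H" for x using h h_id that by simp
  have shift: "f ({x} + A) = {x} + f A" if "x \<in> H" "A \<in> S" for x A
    using hom[of "{x}" A] f_single sing that by simp

  define T where "T = {c..}"
  have T: "T \<in> S" using above by (auto simp: T_def)
  have Inf_T: "Inf T = c" by (simp add: T_def cInf_eq_minimum)
  have Inf_H: "Inf A \<in> H" if "A \<in> S" for A using that Inf_nat_def1[of A] by (auto simp: S_def)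
  have Inf_single: "Inf {x} = x" for x :: nat by simp
  have add_T: "A + T = {Inf A} + T" if "A \<in> S" for A
    using add_atLeast_eq[OF ne[OF that], of c] add_atLeast_eq[of "{Inf A}" c] by (simp add: T_def)
  \<comment> \<open>Adding any set to \<open>T\<close> only translates \<open>T\<close>. Adding the preimage \<open>Y\<close> of \<open>T\<close> and applying \<open>f\<close>
    exhibits \<open>f T + T\<close> both as a translate of \<open>f T\<close> and as a translate of \<open>T\<close>.\<close>
  have f_T: "f T = T"
  proof -
    obtain Y where Y: "Y \<in> S" "f Y = T" using surj T by blast
    have "f (Y + T) = T + f T" using hom Y T by simp
    also have "Y + T = {Inf Y} + T" using add_T Y by simp
    also have "f ({Inf Y} + T) = {Inf Y} + f T" using shift Inf_H Y T by simp
    finally have eq: "{Inf Y} + f T = {Inf (f T)} + T"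
      using add_T[OF mem[OF T]] by (simp add: add.commute)
    \<comment> \<open>Least elements in \<open>eq\<close> give \<open>Inf Y = c\<close>, and in \<open>f T + f T = {c} + f T\<close> they give
      \<open>Inf (f T) = c\<close>; so \<open>eq\<close> reads \<open>{c} + f T = {c} + T\<close>.\<close>
    then have "Inf Y + Inf (f T) = Inf (f T) + Inf T"
      using Inf_add[of "{Inf Y}" "f T"] Inf_add[of "{Inf (f T)}" T] ne mem T Inf_single
      by (metis insert_not_empty)
    then have "Inf Y = c" using Inf_T by simp
    have "f T + f T = f ({c} + T)" using hom[OF T T] add_T[OF T] Inf_T by simp
    also have "\<dots> = {c} + f T" using shift T Inf_H[OF T] Inf_T by simp
    finally have "Inf (f T) + Inf (f T) = c + Inf (f T)"
      using Inf_add[of "f T" "f T"] Inf_add[of "{c}" "f T"] ne mem T Inf_single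
      by (metis insert_not_empty)
    then show "f T = T" using eq \<open>Inf Y = c\<close> singleton_add_inject by simp
  qed
  have Inf_f: "Inf (f A) = Inf A" if A: "A \<in> S" for A
  proof -
    have "{Inf (f A)} + T = f (A + T)" using hom[OF A T] f_T add_T[OF mem[OF A]] by simp
    also have "\<dots> = {Inf A} + T" using add_T[OF A] shift[OF Inf_H[OF A] T] f_T by simp
    finally show ?thesis
      using add_atLeast_eq[of "{Inf (f A)}" c] add_atLeast_eq[of "{Inf A}" c] by (simp add: T_def)
  qed

  have c: "c \<in> H" using cof by auto
  have zero_iff: "0 \<in> A \<longleftrightarrow> Inf ({c} + A) = c" if "A \<noteq> {}" for A :: "nat set"
    using Inf_add[of "{c}" A] that Inf_nat_def1[OF that] wellorder_Inf_le1[of 0 A] by auto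
  have shift_S: "{c} + A \<in> S" if "0 \<in> A" for A :: "nat set"
    using that by (intro above) (auto simp: set_plus_def)
  have unshift: "\<exists>A. 0 \<in> A \<and> {c} + A = B" if "B \<in> S" "Inf B = c" for B
  proof -
    have "{c} + (\<lambda>b. b - c) ` B = B"
    proof -
      have "c + (b - c) = b" if "b \<in> B" for b using \<open>Inf B = c\<close> wellorder_Inf_le1[OF that] by simp
      then show ?thesis by (force simp: set_plus_def)
    qed
    then show ?thesis using zero_iff[of "(\<lambda>b. b - c) ` B"] ne that by (metis image_is_empty)
  qed

  have "\<forall>A. \<exists>B. 0 \<in> A \<longrightarrow> 0 \<in> B \<and> f ({c} + A) = {c} + B"
  proof (intro allI)
    fix A :: "nat set"
    show "\<exists>B. 0 \<in> A \<longrightarrow> 0 \<in> B \<and> f ({c} + A) = {c} + B"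
    proof (cases "0 \<in> A")
      case True
      then have "Inf ({c} + A) = c" using zero_iff by blast
      then have "Inf (f ({c} + A)) = c" using Inf_f shift_S True by simp
      then show ?thesis using unshift mem shift_S True by metis
    qed simp
  qed
  then obtain g where g: "0 \<in> g A" "f ({c} + A) = {c} + g A" if "0 \<in> A" for A by metis
  have g_id: "g A = A" if "0 \<in> A" for A
  proof (rule zero_subsets_automorphism_is_identity[OF _ _ that])
    show "bij_betw g {X. 0 \<in> X} {X. 0 \<in> X}"
    proof (rule bij_betw_imageI)
      show "inj_on g {X. 0 \<in> X}"
      proof (rule inj_onI)
        fix A B assume "A \<in> {X. 0 \<in> X}" "B \<in> {X. 0 \<in> X}" "g A = g B"
        then show "A = B" using g(2) inj shift_S singleton_add_inject by (metis mem_Collect_eq)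
      qed
      show "g ` {X. 0 \<in> X} = {X. 0 \<in> X}"
      proof (intro equalityI subsetI)
        fix B :: "nat set" assume "B \<in> {X. 0 \<in> X}"
        then have B: "0 \<in> B" by simp
        obtain A' where A': "A' \<in> S" "f A' = {c} + B" using surj shift_S B by blast
        have "Inf A' = c" using Inf_f[OF A'(1)] A'(2) zero_iff[of B] B by force
        then obtain A where A: "0 \<in> A" "{c} + A = A'" using unshift A'(1) by blast
        then have "{c} + g A = {c} + B" using g(2) A'(2) by metis
        then show "B \<in> g ` {X. 0 \<in> X}" using singleton_add_inject A(1) by blast
      qed (use g in auto)
    qed
    fix A B :: "nat set" assume AB: "0 \<in> A" "0 \<in> B"
    have AB0: "0 \<in> A + B" using set_plus_intro[OF AB] by simp
    \<comment> \<open>\<open>({c} + A) + ({c} + B)\<close> carries the shift twice; the surplus one passes through \<open>f\<close>.\<close>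
    have "{c} + ({c} + g (A + B)) = f ({c} + ({c} + (A + B)))"
      using shift[OF c shift_S[OF AB0]] g(2)[OF AB0] by simp
    also have "{c} + ({c} + (A + B)) = ({c} + A) + ({c} + B)" by (simp only: ac_simps)
    also have "f \<dots> = ({c} + g A) + ({c} + g B)" using hom shift_S AB g(2) by simp
    also have "\<dots> = {c} + ({c} + (g A + g B))" by (simp only: ac_simps)
    finally show "g (A + B) = g A + g B" by (rule singleton_add_inject[OF singleton_add_inject])
  qed

  have X: "X \<in> S" using X by (simp add: S_def)
  define X0 where "X0 = (\<lambda>x. x - Inf X) ` X"
  have X0: "0 \<in> X0" using Inf_nat_def1[OF ne[OF X]] by (force simp: X0_def)
  have "Inf X + (x - Inf X) = x" if "x \<in> X" for x using wellorder_Inf_le1[OF that] by simp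
  then have "{Inf X} + X0 = X" unfolding X0_def by (force simp: set_plus_def)
  then have shift_X0: "{c} + X = {Inf X} + ({c} + X0)" by (metis add.left_commute)
  have "{c} + f X = f ({c} + X)" using shift c X by simp
  also have "\<dots> = {Inf X} + f ({c} + X0)" using shift_X0 shift[OF Inf_H[OF X] shift_S[OF X0]] by simp
  also have "\<dots> = {c} + X" using shift_X0 g(2)[OF X0] g_id[OF X0] by simp
  finally show "f X = X" by (rule singleton_add_inject)
qed

theorem theorem4p3:
  fixes H :: "nat set"
  assumes "numerical_semigroup H"
  shows "trivial_group (AutoGroup (power_semigroup H))"
proof -
  have closed: "\<forall>x\<in>H. \<forall>y\<in>H. x + y \<in> H" and fin: "finite (UNIV - H)"
    using assms by (auto simp: numerical_semigroup_def)
  obtain c where "\<forall>x\<in>UNIV - H. x < c" using finite_nat_set_iff_bounded fin by blast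
  then have "x \<in> H" if "c \<le> x" for x using that by (meson DiffI UNIV_I not_le)
  then have "{c..} \<subseteq> H" by auto
  show ?thesis
    unfolding trivial_AutoGroup_power_semigroup_iff[OF closed]
  proof (intro allI impI)
    fix f X
    assume f: "bij_betw f {X. X \<subseteq> H \<and> X \<noteq> {}} {X. X \<subseteq> H \<and> X \<noteq> {}} \<and>
        (\<forall>X Y. X \<subseteq> H \<and> X \<noteq> {} \<and> Y \<subseteq> H \<and> Y \<noteq> {} \<longrightarrow> f (X + Y) = f X + f Y)"
      and X: "X \<subseteq> H \<and> X \<noteq> {}"
    show "f X = X"
      by (rule power_semigroup_automorphism_is_identity[OF _ \<open>{c..} \<subseteq> H\<close>]) (use closed f X in simp_all)
  qed
qed

end
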